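(* Let $\gamma,\beta,a>0$. The orthonormal polynomials $(p_n)_{n}$ with respect to the weights $w_k=\frac{(\gamma)_k\,a^k}{k!\,(\beta)_k}$, $k\in\mathbb N$, on the lattice $\mathbb N$, i.e. the polynomials with $$\sum_{k=0}^\infty p_n(k)p_m(k)w_k=\delta_{n,m},$$ satisfy the three-term recurrence relation $$xp_n(x)=a_{n+1}p_{n+1}(x)+b_np_n(x)+a_np_{n-1}(x),$$ where the recurrence coefficients are given by the initial conditions $$a_0=0,\qquad b_0=\frac{\gamma a}{\beta}\,\frac{M(\gamma+1,\beta+1,a)}{M(\gamma,\beta,a)},$$ and $$a_n^2=na-(\gamma-1)u_n,\qquad b_n=n+\gamma-\beta+a-\frac{(\gamma-1)v_n}{a},$$ where $(u_n,v_n)_{n\in\mathbb N}$ satisfy the system of non-linear equations $$(u_n+v_n)(u_{n+1}+v_n)=\frac{\gamma-1}{a^2}\,v_n(v_n-a)\left(v_n-a\frac{\gamma-\beta}{\gamma-1}\right),$$ $$(u_n+v_n)(u_n+v_{n-1})=\frac{u_n}{u_n-\frac{an}{\gamma-1}}\,(u_n+a)\left(u_n+a\frac{\gamma-\beta}{\gamma-1}\right).$$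
   Context: $\mathbb N=\{0,1,2,\ldots\}$; $(x)_k=x(x+1)\cdots(x+k-1)$, $(x)_0=1$, is the Pochhammer symbol; $\delta_{n,m}$ is the Kronecker delta; $p_n$ has degree $n$ and positive leading coefficient. $M(a,b,z)=\sum_{k=0}^\infty\frac{(a)_k}{(b)_k\,k!}z^k={}_1F_1(a;b;z)$ is the confluent hypergeometric function.
   Formalization: The case γ = 1 is excluded: there (γ−β)/(γ−1) and an/(γ−1) are undefined, and the formula for b_n fails (γ=1, β=2 gives b_0 = a e^a/(e^a−1) − 1, not a − 1). *)

theory Defs
  imports "HOL-Analysis.Analysis" "HOL-Computational_Algebra.Polynomial"
begin

definition kummer_M :: "real \<Rightarrow> real \<Rightarrow> real \<Rightarrow> real" where
  "kummer_M a b z = (\<Sum>k. pochhammer a k / (pochhammer b k * fact k) * z ^ k)"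

definition gen_meixner_weight :: "real \<Rightarrow> real \<Rightarrow> real \<Rightarrow> nat \<Rightarrow> real" where
  "gen_meixner_weight \<gamma> \<beta> a k = pochhammer \<gamma> k * a ^ k / (fact k * pochhammer \<beta> k)"

definition orthonormal_polys :: "(nat \<Rightarrow> real) \<Rightarrow> (nat \<Rightarrow> real poly) \<Rightarrow> bool" where
  "orthonormal_polys w p \<longleftrightarrow>
     (\<forall>n. degree (p n) = n \<and> lead_coeff (p n) > 0) \<and>
     (\<forall>n m. (\<lambda>k. poly (p n) (real k) * poly (p m) (real k) * w k)
              sums (if n = m then 1 else 0))"

text \<open>
  At index 0 the term with the polynomial of index \<open>-1\<close> is absent, in accordance with the
  usual convention that this polynomial is 0.
\<close>

definition three_term_recurrence ::
    "(nat \<Rightarrow> real poly) \<Rightarrow> (nat \<Rightarrow> real) \<Rightarrow> (nat \<Rightarrow> real) \<Rightarrow> bool" where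
  "three_term_recurrence p A b \<longleftrightarrow>
     (\<forall>n x. x * poly (p n) x =
        A (Suc n) * poly (p (Suc n)) x + b n * poly (p n) x +
        (if n = 0 then 0 else A n * poly (p (n - 1)) x))"

end

theory Submission
  imports Defs
begin

text \<open>
  The weight satisfies the Pearson equation \<open>k (k + \<beta> - 1) w\<^sub>k = a (k + \<gamma> - 1) w\<^sub>k\<^sub>-\<^sub>1\<close>. With
  \<open>y = x + \<gamma>\<close> it turns the expansion of \<open>y P\<^sub>n(x + 1)\<close> in the monic orthogonal polynomials into
  \<open>y P\<^sub>n(x + 1) = (y + U\<^sub>n) P\<^sub>n(x) + (n - U\<^sub>n) (y - V\<^sub>n) P\<^sub>n\<^sub>-\<^sub>1(x)\<close>, where \<open>U\<^sub>n\<close>, \<open>V\<^sub>n\<close> are \<open>u\<^sub>n\<close>, \<open>v\<^sub>n\<close>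
  divided by \<open>a / (\<gamma> - 1)\<close>. Compatibility with the three-term recurrence makes the determinant of
  the resulting transfer matrix of \<open>(P\<^sub>n, P\<^sub>n\<^sub>-\<^sub>1)\<close> independent of \<open>n\<close>. Evaluating this determinant
  at \<open>y = V\<^sub>n\<^sub>-\<^sub>1\<close> and at \<open>y = - U\<^sub>n\<close>, where one of its two terms vanishes, gives the two equations.
\<close>

section \<open>Coefficients of shifted polynomials\<close>

lemma coeff_shift_top:
  fixes q :: "'a::comm_ring_1 poly"
  assumes "degree q \<le> n"
  shows "coeff (pcompose q [:c, 1:]) n = coeff q n"
  using assms
proof (induction q arbitrary: n)
  case (pCons a q)
  show ?case
  proof (cases n)
    case 0
    with pCons show ?thesis
      by (metis degree_eq_zeroE le_zero_eq pcompose_const)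
  next
    case (Suc m)
    have dq: "degree q \<le> m"
      using pCons.prems Suc by (cases "q = 0") auto
    have "degree (pcompose q [:c, 1:]) \<le> degree q"
      using degree_pcompose_le[of q "[:c, 1:]"] by simp
    then have "coeff (pcompose q [:c, 1:]) (Suc m) = 0"
      using dq by (intro coeff_eq_0) auto
    then show ?thesis
      using pCons.IH[OF dq] Suc by (simp add: pcompose_pCons)
  qed
qed simp

text \<open>In the Taylor expansion of \<open>q (x + c)\<close> only \<open>q\<close> and
  \<open>c * q'\<close> reach the coefficient just below the top.\<close>

lemma coeff_shift_subtop:
  fixes q :: "'a::comm_ring_1 poly"
  assumes "degree q \<le> Suc n"
  shows "coeff (pcompose q [:c, 1:]) n = coeff q n + c * of_nat (Suc n) * coeff q (Suc n)"
  using assms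
proof (induction q arbitrary: n)
  case (pCons a q)
  have dq: "degree q \<le> n"
    using pCons.prems by (cases "q = 0") auto
  note top = coeff_shift_top[OF dq, of c]
  show ?case
  proof (cases n)
    case 0
    with top show ?thesis by (simp add: pcompose_pCons)
  next
    case (Suc m)
    then show ?thesis
      using pCons.IH[of m] dq top by (simp add: pcompose_pCons algebra_simps)
  qed
qed simp

lemma degree_shift_le:
  fixes q :: "'a::comm_ring_1 poly"
  shows "degree (pcompose q [:c, 1:]) \<le> degree q"
  using degree_pcompose_le[of q "[:c, 1:]"] by simp

section \<open>Monic orthogonal polynomials of a general weight and their recurrence\<close>

locale orthonormal_poly_seq =
  fixes w :: "nat \<Rightarrow> real" and p :: "nat \<Rightarrow> real poly"
  assumes ortho: "orthonormal_polys w p"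
begin

definition lc :: "nat \<Rightarrow> real" where "lc n = lead_coeff (p n)"

definition P :: "nat \<Rightarrow> real poly" where "P n = smult (1 / lc n) (p n)"

text \<open>The moment functional of the weight; its series converges for every polynomial by
  \<open>summable_poly\<close>.\<close>

definition L :: "real poly \<Rightarrow> real" where "L q = (\<Sum>k. poly q (real k) * w k)"

text \<open>The difference of the subleading coefficients of \<open>P n\<close> and \<open>P (Suc n)\<close>; writing it with
  \<open>pCons 0 (P n) = x * P n\<close> gives \<open>P 0\<close> the subleading coefficient 0.\<close>

definition B :: "nat \<Rightarrow> real" where
  "B n = coeff (pCons 0 (P n)) n - coeff (P (Suc n)) n"

text \<open>As \<open>1 / lc n\<close> is the norm of \<open>P n\<close>, this is a ratio of
  consecutive norms. The value 0 at index 0 removes the terms whose index \<open>n - 1\<close> or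
  \<open>n - 2\<close> gets truncated.\<close>

definition A :: "nat \<Rightarrow> real" where
  "A n = (if n = 0 then 0 else lc (n - 1) / lc n)"

lemma lc_pos: "lc n > 0"
  using ortho unfolding orthonormal_polys_def lc_def by blast

lemma degree_p: "degree (p n) = n"
  using ortho by (simp add: orthonormal_polys_def)

lemma degree_P [simp]: "degree (P n) = n"
  using lc_pos[of n] by (simp add: P_def degree_p)

lemma coeff_P_top [simp]: "coeff (P n) n = 1"
  using lc_pos[of n] degree_p[of n] by (simp add: P_def lc_def)

lemma P_0: "P 0 = 1"
proof -
  obtain c where "P 0 = [:c:]"
    using degree_eq_zeroE[OF degree_P[of 0]] .
  with coeff_P_top[of 0] show ?thesis
    by (simp add: one_pCons)
qed

lemma p_eq: "p n = smult (lc n) (P n)"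
  using lc_pos[of n] by (simp add: P_def)

lemma p_sums: "(\<lambda>k. poly (p n * p m) (real k) * w k) sums (if n = m then 1 else 0)"
  using ortho by (simp add: orthonormal_polys_def)

lemma summable_P: "summable (\<lambda>k. poly (P n) (real k) * w k)"
proof -
  \<comment> \<open>Convergence is given for products \<open>p n * p m\<close>; taking
    \<open>m = 0\<close> makes the second factor constant.\<close>
  have "summable (\<lambda>k. poly (p n * p 0) (real k) * w k)"
    using p_sums sums_summable by blast
  then have "summable (\<lambda>k. 1 / (lc n * lc 0) * (poly (p n * p 0) (real k) * w k))"
    by (rule summable_mult)
  then show ?thesis
    using lc_pos[of n] lc_pos[of 0] by (simp add: p_eq P_0)
qed

lemma reduce_degree:
  assumes "degree q \<le> n"
  obtains r where "q = r + smult (coeff q n) (P n)" "r = 0 \<or> degree r < n"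
proof
  define r where "r = q - smult (coeff q n) (P n)"
  show "q = r + smult (coeff q n) (P n)"
    by (simp add: r_def)
  have "degree r \<le> n" "coeff r n = 0"
    using assms degree_diff_le[of q n "smult (coeff q n) (P n)"] by (auto simp: r_def)
  then show "r = 0 \<or> degree r < n"
    using eq_zero_or_degree_less by blast
qed

text \<open>Induction along the basis \<open>P\<close>, by stripping leading terms. The bound
  \<open>n \<le> degree q\<close> is what lets \<open>L_P_less\<close> use orthogonality.\<close>

lemma P_induct [case_names zero add]:
  assumes "Z 0"
    and "\<And>r n c. Z r \<Longrightarrow> n \<le> degree q \<Longrightarrow> Z (r + smult c (P n))"
  shows "Z q"
  using assms
proof (induction "degree q" arbitrary: q rule: less_induct)
  case less
  obtain r where r: "q = r + smult (lead_coeff q) (P (degree q))" "r = 0 \<or> degree r < degree q"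
    using reduce_degree by blast
  have "Z r"
    using r(2) less.hyps[of r] less.prems by (auto simp: dual_order.strict_implies_order)
  then show ?case
    using r(1) less.prems(2) by (metis order_refl)
qed

lemma summable_poly: "summable (\<lambda>k. poly q (real k) * w k)"
proof (induction q rule: P_induct)
  case (add r n c)
  from summable_add[OF add(1) summable_mult[OF summable_P, of c n]]
  show ?case by (simp add: algebra_simps)
qed simp

lemma L_add: "L (q + r) = L q + L r"
  using suminf_add[OF summable_poly[of q] summable_poly[of r]]
  by (simp add: L_def algebra_simps)

lemma L_smult: "L (smult c q) = c * L q"
  using suminf_mult[OF summable_poly[of q], of c] by (simp add: L_def algebra_simps)

lemma L_0 [simp]: "L 0 = 0"
  by (simp add: L_def)

lemma L_diff: "L (q - r) = L q - L r"
  using L_add[of "q - r" r] by simp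

lemma L_P_P: "L (P n * P m) = (if n = m then 1 / (lc n)\<^sup>2 else 0)"
proof -
  have "L (p n * p m) = (if n = m then 1 else 0)"
    unfolding L_def by (rule sums_unique[OF p_sums, symmetric])
  moreover have "P n * P m = smult (1 / (lc n * lc m)) (p n * p m)"
    by (simp add: P_def mult.commute)
  ultimately show ?thesis
    by (simp add: L_smult power2_eq_square)
qed

lemma L_P_less:
  assumes "degree q < n"
  shows "L (P n * q) = 0"
proof (induction q rule: P_induct)
  case (add r m c)
  with assms show ?case by (simp add: distrib_left L_add L_smult L_P_P)
qed simp

lemma L_P_top:
  assumes "degree q \<le> n"
  shows "L (P n * q) = coeff q n / (lc n)\<^sup>2"
proof -
  obtain r where r: "q = r + smult (coeff q n) (P n)" "r = 0 \<or> degree r < n"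
    using reduce_degree[OF assms] .
  then have "L (P n * r) = 0"
    using L_P_less by auto
  then show ?thesis
    by (subst r(1)) (simp add: distrib_left L_add L_smult L_P_P)
qed

text \<open>The component of \<open>q\<close> along \<open>P (Suc n)\<close> is orthogonal to
  \<open>P n\<close>; removing it reduces the claim to \<open>L_P_top\<close>.\<close>

lemma L_P_subtop:
  assumes "degree q \<le> Suc n"
  shows "L (P n * q) = (coeff q n - coeff q (Suc n) * coeff (P (Suc n)) n) / (lc n)\<^sup>2"
proof -
  obtain r where r: "q = r + smult (coeff q (Suc n)) (P (Suc n))" "r = 0 \<or> degree r < Suc n"
    using reduce_degree[OF assms] .
  have "L (P n * q) = L (P n * r)"
    by (subst r(1)) (simp add: distrib_left L_add L_smult L_P_P)
  also have "\<dots> = coeff r n / (lc n)\<^sup>2"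
    using r(2) by (intro L_P_top) auto
  also have "coeff r n = coeff q n - coeff q (Suc n) * coeff (P (Suc n)) n"
    using arg_cong[OF r(1), of "\<lambda>q. coeff q n"] by simp
  finally show ?thesis .
qed

text \<open>Pairing \<open>q\<close> with \<open>P (degree q)\<close> isolates its leading
  coefficient. Both expansions below rest on this: the two top coefficients are matched first, then
  the difference is tested against the lower \<open>P m\<close>.\<close>

lemma orthogonal_imp_0:
  assumes "degree q < n" "\<And>m. m < n \<Longrightarrow> L (P m * q) = 0"
  shows "q = 0"
  using assms(2)[OF assms(1)] L_P_top[of q "degree q"] lc_pos[of "degree q"] by simp

lemma P_recurrence:
  "pCons 0 (P n) = P (Suc n) + smult (B n) (P n) + smult ((A n)\<^sup>2) (P (n - 1))"
proof -
  define q where "q = pCons 0 (P n) - P (Suc n) - smult (B n) (P n) - smult ((A n)\<^sup>2) (P (n - 1))"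
  have dq: "degree q \<le> Suc n"
    unfolding q_def by (intro degree_diff_le order.trans[OF degree_smult_le]) (auto simp: degree_pCons_eq_if)
  have "coeff (P n) (Suc n) = 0" "coeff (P (n - 1)) (Suc n) = 0"
    by (simp_all add: coeff_eq_0)
  then have dq: "q = 0 \<or> degree q < Suc n"
    using dq by (intro eq_zero_or_degree_less) (auto simp: q_def)
  have "coeff q n = 0"
    by (cases n) (auto simp: q_def B_def A_def coeff_eq_0)
  then have dq: "q = 0 \<or> degree q < n"
    using dq eq_zero_or_degree_less[of q n] by auto
  have "q = 0"
  proof (rule ccontr)
    assume "q \<noteq> 0"
    with dq obtain m where m: "degree q < n" "n = Suc m"
      by (cases n) auto
    have "q = 0"
    proof (rule orthogonal_imp_0[OF m(1)])
      fix k assume k: "k < n"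
      \<comment> \<open>Moving the factor \<open>x\<close> over to \<open>P k\<close> leaves degree
        at most \<open>n\<close>, so the pairing with \<open>P n\<close> is nonzero only for
        \<open>k = n - 1\<close>.\<close>
      have "P k * pCons 0 (P n) = P n * pCons 0 (P k)"
        by (simp add: mult.commute)
      then have "L (P k * pCons 0 (P n)) = coeff (pCons 0 (P k)) n / (lc n)\<^sup>2"
        using k by (simp add: L_P_top degree_pCons_eq_if del: mult_pCons_right)
      moreover have "coeff (P k) m = (if k = m then 1 else 0)"
        using k m by (auto simp: coeff_eq_0)
      ultimately show "L (P k * q) = 0"
        using k m lc_pos[of m]
        by (auto simp: q_def right_diff_distrib L_diff L_smult L_P_P A_def power_divide
            simp del: mult_pCons_right)
    qed
    with \<open>q \<noteq> 0\<close> show False by simp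
  qed
  then show ?thesis
    unfolding q_def by (simp add: algebra_simps)
qed

lemma P_recurrence_poly:
  "poly (P (Suc n)) x = (x - B n) * poly (P n) x - (A n)\<^sup>2 * poly (P (n - 1)) x"
  using arg_cong[OF P_recurrence[of n], of "\<lambda>q. poly q x"] by (simp add: algebra_simps)

lemma A_0 [simp]: "A 0 = 0"
  by (simp add: A_def)

lemma A_lc:
  "A (Suc n) * lc (Suc n) = lc n"
  "A (Suc n) * lc n = (A (Suc n))\<^sup>2 * lc (Suc n)"
  using lc_pos[of "Suc n"] by (simp_all add: A_def power2_eq_square)

lemma three_term: "three_term_recurrence p A B"
  unfolding three_term_recurrence_def
proof (intro allI)
  fix n x
  have "x * poly (p n) x = lc n * (poly (P (Suc n)) x + B n * poly (P n) x
      + (A n)\<^sup>2 * poly (P (n - 1)) x)"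
    unfolding P_recurrence_poly[of n x] by (simp add: p_eq algebra_simps)
  also have "\<dots> = A (Suc n) * poly (p (Suc n)) x + B n * poly (p n) x +
        (if n = 0 then 0 else A n * poly (p (n - 1)) x)"
  proof -
    have "lc n * poly (P (Suc n)) x = A (Suc n) * poly (p (Suc n)) x"
      using A_lc(1)[of n] by (simp add: p_eq)
    moreover have "lc n * ((A n)\<^sup>2 * poly (P (n - 1)) x) =
        (if n = 0 then 0 else A n * poly (p (n - 1)) x)"
      using A_lc(2)[of "n - 1"] by (cases n) (simp_all add: p_eq)
    moreover have "lc n * (B n * poly (P n) x) = B n * poly (p n) x"
      by (simp add: p_eq)
    ultimately show ?thesis
      by (simp only: distrib_left)
  qed
  finally show "x * poly (p n) x = A (Suc n) * poly (p (Suc n)) x + B n * poly (p n) x +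
        (if n = 0 then 0 else A n * poly (p (n - 1)) x)" .
qed

lemma A_pos: "n > 0 \<Longrightarrow> A n > 0"
  using lc_pos by (simp add: A_def)

lemma B_0: "L 1 * B 0 = L [:0, 1:]"
  using L_P_subtop[of "[:0, 1:]" 0] L_P_top[of 1 0] by (simp add: P_0 B_def)

text \<open>The degrees differ. This turns an identity in \<open>x\<close> into the vanishing of its
  two constant coefficients.\<close>

lemma P_independent:
  assumes "n > 0" "\<And>x. F * poly (P n) x + G * poly (P (n - 1)) x = 0"
  shows "F = 0" "G = 0"
proof -
  have "smult F (P n) + smult G (P (n - 1)) = 0"
    using assms(2) by (intro poly_ext) simp
  then have c: "F * coeff (P n) k + G * coeff (P (n - 1)) k = 0" for k
    by (metis coeff_0 coeff_add coeff_smult)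
  show F: "F = 0"
    using c[of n] assms(1) by (simp add: coeff_eq_0)
  show "G = 0"
    using c[of "n - 1"] F by simp
qed

end

section \<open>The generalized Meixner weight: Pearson equation and low moments\<close>

locale gen_meixner_polys = orthonormal_poly_seq "gen_meixner_weight \<gamma> \<beta> a" p
  for \<gamma> \<beta> a :: real and p +
  assumes pos: "\<gamma> > 0" "\<beta> > 0" "a > 0"
begin

lemma weight_Suc:
  "real (Suc k) * (real k + \<beta>) * gen_meixner_weight \<gamma> \<beta> a (Suc k)
   = a * (real k + \<gamma>) * gen_meixner_weight \<gamma> \<beta> a k"
proof -
  have "gen_meixner_weight \<gamma> \<beta> a (Suc k) =
      a * (real k + \<gamma>) * gen_meixner_weight \<gamma> \<beta> a k / (real (Suc k) * (real k + \<beta>))"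
    by (simp add: gen_meixner_weight_def pochhammer_Suc ac_simps del: of_nat_Suc)
  moreover have "real k + \<beta> \<noteq> 0"
    using pos(2) by linarith
  ultimately show ?thesis
    by (simp del: of_nat_Suc)
qed

text \<open>Summed form of \<open>weight_Suc\<close>: the factor \<open>x\<close> kills the term at
  \<open>k = 0\<close>, so the index can be shifted by one.\<close>

lemma L_pearson:
  "L ([:0, 1:] * [:\<beta> - 1, 1:] * q) = a * L ([:\<gamma>, 1:] * pcompose q [:1, 1:])"
proof -
  let ?f = "\<lambda>k. poly ([:0, 1:] * [:\<beta> - 1, 1:] * q) (real k) * gen_meixner_weight \<gamma> \<beta> a k"
  let ?g = "\<lambda>k. poly ([:\<gamma>, 1:] * pcompose q [:1, 1:]) (real k) * gen_meixner_weight \<gamma> \<beta> a k"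
  have "?f (Suc k) = a * ?g k" for k
  proof -
    have "?f (Suc k) = (real (Suc k) * (real k + \<beta>) * gen_meixner_weight \<gamma> \<beta> a (Suc k)) * poly q (1 + real k)"
      by (simp add: algebra_simps)
    also have "\<dots> = a * ?g k"
      unfolding weight_Suc by (simp add: poly_pcompose algebra_simps)
    finally show ?thesis .
  qed
  moreover have "(\<Sum>k. ?f (Suc k)) = suminf ?f - ?f 0"
    by (rule suminf_split_head) (rule summable_poly)
  moreover have "(\<Sum>k. a * ?g k) = a * suminf ?g"
    by (rule suminf_mult) (rule summable_poly)
  ultimately show ?thesis
    by (simp add: L_def)
qed

lemma L_1: "L 1 = kummer_M \<gamma> \<beta> a"
  by (simp add: L_def kummer_M_def gen_meixner_weight_def mult.commute)

text \<open>The factor \<open>k\<close> cancels into \<open>k!\<close>, and splitting off the first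
  factor of each Pochhammer symbol raises both parameters by one.\<close>

lemma L_X: "L [:0, 1:] = \<gamma> * a / \<beta> * kummer_M (\<gamma> + 1) (\<beta> + 1) a"
proof -
  let ?f = "\<lambda>k. poly [:0, 1:] (real k) * gen_meixner_weight \<gamma> \<beta> a k"
  let ?g = "\<lambda>k. pochhammer (\<gamma> + 1) k / (pochhammer (\<beta> + 1) k * fact k) * a ^ k"
  have eq: "?f (Suc k) = \<gamma> * a / \<beta> * ?g k" for k
    by (simp add: gen_meixner_weight_def pochhammer_rec mult_ac)
  have s: "summable (\<lambda>k. \<gamma> * a / \<beta> * ?g k)"
    using summable_poly[of "[:0, 1:]"] unfolding eq[symmetric] by (subst summable_Suc_iff)
  have "summable ?g"
    using summable_mult[OF s, of "\<beta> / (\<gamma> * a)"] pos by simp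
  then have "(\<Sum>k. ?f (Suc k)) = \<gamma> * a / \<beta> * suminf ?g"
    unfolding eq by (rule suminf_mult)
  moreover have "(\<Sum>k. ?f (Suc k)) = suminf ?f - ?f 0"
    by (rule suminf_split_head) (rule summable_poly)
  ultimately show ?thesis
    by (simp add: L_def kummer_M_def)
qed

lemma L_1_eq: "L 1 = 1 / (lc 0)\<^sup>2"
  using L_P_P[of 0 0] by (simp add: P_0)

lemma B_0_kummer:
  "B 0 = \<gamma> * a / \<beta> * (kummer_M (\<gamma> + 1) (\<beta> + 1) a / kummer_M \<gamma> \<beta> a)"
proof -
  have "L 1 > 0"
    using lc_pos[of 0] by (simp add: L_1_eq)
  then have "B 0 = L [:0, 1:] / L 1"
    using B_0 by (simp add: eq_divide_eq mult.commute)
  then show ?thesis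
    by (simp add: L_1 L_X)
qed

text \<open>Squaring \<open>x = P 1 + B 0\<close> leaves, by orthogonality, the squared norm of
  \<open>P 1\<close> and \<open>(B 0)^2 * L 1\<close>.\<close>

lemma L_X2: "L [:0, 0, 1:] = ((A 1)\<^sup>2 + (B 0)\<^sup>2) * L 1"
proof -
  have P1: "[:0, 1:] = P 1 + [:B 0:]"
    using P_recurrence[of 0] by (simp add: P_0 one_pCons)
  have "[:0, 0, 1:] = P 1 * P 1 + smult (2 * B 0) (P 1 * P 0) + smult ((B 0)\<^sup>2) 1"
  proof -
    have "[:0, 0, 1:] = [:0, 1:] * ([:0, 1:] :: real poly)" by simp
    also have "\<dots> = P 1 * P 1 + smult (2 * B 0) (P 1 * P 0) + smult ((B 0)\<^sup>2) 1"
      unfolding P1 P_0 by (intro poly_ext) (simp add: algebra_simps power2_eq_square)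
    finally show ?thesis .
  qed
  then have "L [:0, 0, 1:] = 1 / (lc 1)\<^sup>2 + (B 0)\<^sup>2 * L 1"
    by (simp only: L_add L_smult L_P_P) simp
  then show ?thesis
    using lc_pos[of 0] by (simp add: L_1_eq A_def field_simps)
qed

text \<open>\<open>L_pearson\<close> for the constant 1 links the moments of order 0, 1 and 2. The
  result feeds the base case of \<open>determinant\<close>.\<close>

lemma A_1_sq: "(A 1)\<^sup>2 = (a + 1 - \<beta>) * B 0 + a * \<gamma> - (B 0)\<^sup>2"
proof -
  have "L ([:0, 0, 1:] + smult (\<beta> - 1) [:0, 1:]) = a * L (smult \<gamma> 1 + [:0, 1:])"
    using L_pearson[of 1] by (simp add: one_pCons pcompose_pCons)
  then have "((A 1)\<^sup>2 + (B 0)\<^sup>2 + (\<beta> - 1) * B 0) * L 1 = (a * \<gamma> + a * B 0) * L 1"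
    unfolding L_add L_smult L_X2 B_0[symmetric] by (simp add: algebra_simps)
  then have "(A 1)\<^sup>2 + (B 0)\<^sup>2 + (\<beta> - 1) * B 0 = a * \<gamma> + a * B 0"
    using lc_pos[of 0] by (simp add: L_1_eq)
  then show ?thesis
    by (simp add: algebra_simps)
qed

section \<open>Expansion of the shifted polynomial in the orthogonal basis\<close>

lemma L_P_mult_shift:
  "a * L (P m * ([:\<gamma>, 1:] * pcompose (P n) [:1, 1:])) =
   L (P n * ([:0, 1:] * [:\<beta> - 1, 1:] * pcompose (P m) [:-1, 1:]))"
proof -
  have "pcompose (pcompose (P m) [:-1, 1:]) [:1, 1:] = P m"
    by (simp add: pcompose_pCons flip: pcompose_assoc)
  then show ?thesis
    using L_pearson[of "P n * pcompose (P m) [:-1, 1:]"]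
    by (simp only: pcompose_mult mult_ac)
qed

text \<open>The factor next to \<open>P n\<close> is monic of degree \<open>m + 2\<close>, so only
  its two highest coefficients can contribute.\<close>

lemma L_P_mult_backshift:
  assumes "m < n"
  shows "L (P n * ([:0, 1:] * [:\<beta> - 1, 1:] * pcompose (P m) [:-1, 1:])) =
    (if n = m + 1 then B m + B n + \<beta> - real n else if n = m + 2 then 1 else 0) / (lc n)\<^sup>2"
proof -
  define R where "R = pcompose (P m) [:-1, 1:]"
  define Q where "Q = pCons 0 (pCons 0 R + smult (\<beta> - 1) R)"
  have Q: "Q = [:0, 1:] * [:\<beta> - 1, 1:] * pcompose (P m) [:-1, 1:]"
    by (simp add: Q_def R_def algebra_simps)
  have dR: "degree R \<le> m"
    using degree_shift_le[of "P m" "-1"] by (simp add: R_def)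
  then have R0: "coeff R (Suc m) = 0" "coeff R (Suc (Suc m)) = 0"
    by (auto intro: coeff_eq_0)
  have R1: "coeff R m = 1"
    using coeff_shift_top[of "P m" m "-1"] by (simp add: R_def)
  \<comment> \<open>The backward shift lowers the subleading coefficient by \<open>m\<close>;
    \<open>pCons 0\<close> makes this hold at \<open>m = 0\<close> too.\<close>
  have R2: "coeff (pCons 0 R) m = coeff (pCons 0 (P m)) m - real m"
    using coeff_shift_subtop[of "P m" "m - 1" "-1"] by (cases m) (auto simp: R_def)
  have dQ: "degree Q \<le> m + 2"
    unfolding Q_def using dR
    by (auto simp: degree_pCons_eq_if intro!: degree_add_le order.trans[OF degree_smult_le])
  have cQ: "coeff Q (Suc (Suc m)) = 1" "coeff Q (Suc m) = coeff (pCons 0 (P m)) m - real m + \<beta> - 1"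
    using R0 R1 R2 by (simp_all add: Q_def)
  consider "n = m + 1" | "n = m + 2" | "n > m + 2"
    using assms by linarith
  then have "L (P n * Q) = (if n = m + 1 then B m + B n + \<beta> - real n else if n = m + 2 then 1 else 0) / (lc n)\<^sup>2"
  proof cases
    case 1
    then show ?thesis
      using L_P_subtop[of Q n] dQ cQ by (simp add: B_def)
  next
    case 2
    then show ?thesis
      using L_P_top[of Q n] dQ cQ by simp
  next
    case 3
    then show ?thesis
      using L_P_less[of Q n] dQ by simp
  qed
  then show ?thesis
    by (simp only: Q)
qed

text \<open>\<open>L_P_mult_shift\<close> moves the shift onto the test polynomial
  \<open>P m\<close>, so no component below \<open>n - 2\<close> survives.\<close>

lemma shift_expansion:
  "[:\<gamma>, 1:] * pcompose (P n) [:1, 1:] = P (Suc n) + smult (B n + real n + \<gamma>) (P n)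
     + smult ((A n)\<^sup>2 / a * (B (n - 1) + B n + \<beta> - real n)) (P (n - 1))
     + smult ((A n)\<^sup>2 * (A (n - 1))\<^sup>2 / a) (P (n - 2))"
proof -
  let ?S = "pcompose (P n) [:1, 1:]"
  define f where "f = (A n)\<^sup>2 / a * (B (n - 1) + B n + \<beta> - real n)"
  define g where "g = (A n)\<^sup>2 * (A (n - 1))\<^sup>2 / a"
  define q where "q = [:\<gamma>, 1:] * ?S - (P (Suc n) + smult (B n + real n + \<gamma>) (P n)
     + smult f (P (n - 1)) + smult g (P (n - 2)))"
  have S: "degree ?S \<le> n" "coeff ?S n = 1" "coeff ?S (Suc n) = 0"
    "coeff (pCons 0 ?S) n = coeff (pCons 0 (P n)) n + real n"
    using degree_shift_le[of "P n" 1] coeff_shift_top[of "P n" n 1]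
      coeff_shift_subtop[of "P n" "n - 1" 1]
    by (auto simp: coeff_eq_0 split: nat.splits)
       (cases n, auto)
  have fg: "n = 0 \<Longrightarrow> f = 0" "n \<le> 1 \<Longrightarrow> g = 0"
    by (auto simp: f_def g_def le_Suc_eq)
  have "degree q \<le> Suc n"
    unfolding q_def using S(1)
    by (intro degree_diff_le degree_add_le order.trans[OF degree_smult_le])
       (auto simp: degree_pCons_eq_if intro!: degree_add_le order.trans[OF degree_smult_le])
  moreover have "coeff q (Suc n) = 0"
    using S by (simp add: q_def coeff_eq_0)
  ultimately have "q = 0 \<or> degree q < Suc n"
    by (rule eq_zero_or_degree_less)
  moreover have "coeff q n = 0"
    using S fg by (cases n) (auto simp: q_def B_def coeff_eq_0)
  ultimately have dq: "q = 0 \<or> degree q < n"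
    using eq_zero_or_degree_less[of q n] by auto
  have "L (P m * q) = 0" if m: "m < n" for m
  proof -
    have "L (P m * q) = L (P m * ([:\<gamma>, 1:] * ?S))
       - (if m = n - 1 then f / (lc m)\<^sup>2 else 0) - (if m = n - 2 then g / (lc m)\<^sup>2 else 0)"
      using m by (simp add: q_def right_diff_distrib distrib_left L_diff L_add L_smult L_P_P
          del: mult_pCons_left mult_pCons_right)
    also have "L (P m * ([:\<gamma>, 1:] * ?S)) = (if n = m + 1 then B m + B n + \<beta> - real n
        else if n = m + 2 then 1 else 0) / (a * (lc n)\<^sup>2)"
    proof -
      have divide: "x = z / (a * c)" if "a * x = z / c" for x z c
        using that pos(3) by (metis divide_divide_eq_left' less_irrefl nonzero_mult_div_cancel_left)
      show ?thesis
        by (rule divide) (rule trans[OF L_P_mult_shift L_P_mult_backshift[OF m]])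
    qed
    finally have *: "L (P m * q) = (if n = m + 1 then B m + B n + \<beta> - real n
        else if n = m + 2 then 1 else 0) / (a * (lc n)\<^sup>2)
       - (if m = n - 1 then f / (lc m)\<^sup>2 else 0) - (if m = n - 2 then g / (lc m)\<^sup>2 else 0)" .
    \<comment> \<open>For \<open>n = 1\<close> truncation makes \<open>n - 1\<close> and
      \<open>n - 2\<close> both 0; \<open>g = 0\<close> then removes the extra term.\<close>
    have index: "m = n - 1 \<longleftrightarrow> n = m + 1" "m = n - 2 \<longleftrightarrow> n = m + 2 \<or> n = 1"
      using m by auto
    consider "n = m + 1" "m = 0" | "n = m + 1" "m > 0" | "n = m + 2" | "n > m + 2"
      using m by linarith
    then show ?thesis
      using *[unfolded index] fg lc_pos[of n] lc_pos[of "n - 1"] lc_pos[of m] pos(3)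
      by cases (auto simp: f_def g_def A_def field_simps)
  qed
  with dq have "q = 0"
    using orthogonal_imp_0 by blast
  then show ?thesis
    by (simp add: q_def f_def g_def)
qed

section \<open>The structure relation, its compatibility and the invariant determinant\<close>

definition U :: "nat \<Rightarrow> real" where "U n = real n - (A n)\<^sup>2 / a"

definition V :: "nat \<Rightarrow> real" where "V n = real n + \<gamma> - \<beta> + a - B n"

lemma B_eq: "B n = real n + \<gamma> - \<beta> + a - V n"
  by (simp add: V_def)

lemma A_sq: "(A n)\<^sup>2 = a * (real n - U n)"
  using pos by (simp add: U_def)

text \<open>This is \<open>shift_expansion\<close> with \<open>P (Suc n)\<close> and
  \<open>P (n - 2)\<close> eliminated by the three-term recurrence.\<close>

lemma structure_relation:
  "y * poly (P n) (y - \<gamma> + 1) = (y + U n) * poly (P n) (y - \<gamma>)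
     + (real n - U n) * (y - V n) * poly (P (n - 1)) (y - \<gamma>)"
proof -
  define x where "x = y - \<gamma>"
  have y: "y = x + \<gamma>" by (simp add: x_def)
  have e: "(x + \<gamma>) * poly (P n) (x + 1) = poly (P (Suc n)) x + (B n + real n + \<gamma>) * poly (P n) x
     + (A n)\<^sup>2 / a * (B (n - 1) + B n + \<beta> - real n) * poly (P (n - 1)) x
     + (A n)\<^sup>2 / a * ((A (n - 1))\<^sup>2 * poly (P (n - 2)) x)"
    using arg_cong[OF shift_expansion[of n], of "\<lambda>q. poly q x"]
    by (simp add: poly_pcompose algebra_simps)
  \<comment> \<open>The recurrence is used at index \<open>n - 1\<close>; for \<open>n = 0\<close>,
    where \<open>Suc (n - 1)\<close> is not \<open>n\<close>, both sides vanish because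
    \<open>A 0 = 0\<close>.\<close>
  have "(A n)\<^sup>2 / a * ((A (n - 1))\<^sup>2 * poly (P (n - 2)) x)
      = (A n)\<^sup>2 / a * ((x - B (n - 1)) * poly (P (n - 1)) x - poly (P n) x)"
    using P_recurrence_poly[of "n - 1" x] by (cases n) (auto simp: numeral_2_eq_2)
  then have e': "(x + \<gamma>) * poly (P n) (x + 1) =
      (x - B n) * poly (P n) x - (A n)\<^sup>2 * poly (P (n - 1)) x + (B n + real n + \<gamma>) * poly (P n) x
      + (A n)\<^sup>2 / a * (B (n - 1) + B n + \<beta> - real n) * poly (P (n - 1)) x
      + (A n)\<^sup>2 / a * ((x - B (n - 1)) * poly (P (n - 1)) x - poly (P n) x)"
    using e unfolding P_recurrence_poly[of n] by (simp only:)
  define r where "r = (A n)\<^sup>2 / a"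
  have Ar: "(A n)\<^sup>2 = a * r" and Ur: "U n = real n - r"
    using pos by (simp_all add: r_def U_def)
  have "(x + \<gamma>) * poly (P n) (x + 1) =
      (x - B n) * poly (P n) x - a * r * poly (P (n - 1)) x + (B n + real n + \<gamma>) * poly (P n) x
      + r * (B (n - 1) + B n + \<beta> - real n) * poly (P (n - 1)) x
      + r * ((x - B (n - 1)) * poly (P (n - 1)) x - poly (P n) x)"
    using e' pos(3) by (simp add: Ar)
  then show ?thesis
    unfolding Ur V_def x_def by (simp add: algebra_simps)
qed

lemma U_0 [simp]: "U 0 = 0"
  by (simp add: U_def)

text \<open>Shifting \<open>x\<close> and raising \<open>n\<close> commute; comparing the two ways of expanding
  \<open>y P\<^sub>n\<^sub>+\<^sub>2(x + 1)\<close> in terms of \<open>P\<^sub>n\<^sub>+\<^sub>1(x)\<close> and \<open>P\<^sub>n(x)\<close>, the terms containing \<open>y\<close> cancel.\<close>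

lemma compatibility:
  defines "\<kappa> \<equiv> \<lambda>n. B n + \<gamma>"
  shows "(1 - \<kappa> (Suc n)) * U (Suc n) - (real (Suc n) - U (Suc n)) * V n
      + U (Suc (Suc n)) * \<kappa> (Suc n) + (real (Suc (Suc n)) - U (Suc (Suc n))) * V (Suc (Suc n)) = 0"
      (is "?F = 0")
    and "a * (U (Suc (Suc n)) - U n) - (1 - \<kappa> (Suc n)) * V (Suc n) - V n * \<kappa> n = 0"
      (is "?G = 0")
proof -
  define r where "r = real (Suc n) - U (Suc n)"
  have Ar: "(A (Suc n))\<^sup>2 = a * r"
    using A_sq[of "Suc n"] by (simp only: r_def)
  have "(A (Suc n))\<^sup>2 > 0"
    using A_pos by (intro zero_less_power) auto
  then have r: "r > 0"
    unfolding Ar using pos(3) by (rule zero_less_mult_pos)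
  have *: "?F * poly (P (Suc n)) x + (r * ?G) * poly (P n) x = 0" for x
  proof -
    define y where "y = x + \<gamma>"
    have x: "y - \<gamma> = x" by (simp add: y_def)
    note E = structure_relation[of y, unfolded x]
    define p0 p1 q0 q1 where "p0 = poly (P n) x" "p1 = poly (P (Suc n)) x"
      "q0 = poly (P n) (x + 1)" "q1 = poly (P (Suc n)) (x + 1)"
    note p_defs = this
    \<comment> \<open>On the left the recurrence is applied at \<open>x + 1\<close>; on the right
      the structure relation comes first, then the recurrence at \<open>x\<close>.\<close>
    have e1: "y * ((x + 1 - B (Suc n)) * q1 - a * r * q0) =
        (y + U (Suc (Suc n))) * ((x - B (Suc n)) * p1 - a * r * p0)
        + (real (Suc (Suc n)) - U (Suc (Suc n))) * (y - V (Suc (Suc n))) * p1"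
      using E[of "Suc (Suc n)"] unfolding P_recurrence_poly[of "Suc n"] by (simp only: Ar p_defs diff_Suc_1 x r_def[symmetric])
    have e2: "y * q1 = (y + U (Suc n)) * p1 + r * (y - V (Suc n)) * p0"
      using E[of "Suc n"] by (simp add: r_def p_defs)
    have "(A n)\<^sup>2 * poly (P (n - 1)) x = (x - B n) * p0 - p1"
      using P_recurrence_poly[of n x] by (simp add: p_defs)
    \<comment> \<open>The factor \<open>a\<close> turns \<open>n - U n\<close> into
      \<open>(A n)^2\<close>, so \<open>P (n - 1)\<close> is eliminated without a division.\<close>
    moreover have "a * y * q0 = a * (y + U n) * p0 + (y - V n) * ((A n)\<^sup>2 * poly (P (n - 1)) x)"
      using arg_cong[OF E[of n], of "\<lambda>z. a * z"] by (simp add: A_sq p_defs algebra_simps)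
    ultimately have e3: "a * y * q0 = a * (y + U n) * p0 + (y - V n) * ((x - B n) * p0 - p1)"
      by simp
    have "(x + 1 - B (Suc n)) * ((y + U (Suc n)) * p1 + r * (y - V (Suc n)) * p0)
        - r * (a * (y + U n) * p0 + (y - V n) * ((x - B n) * p0 - p1)) =
        (y + U (Suc (Suc n))) * ((x - B (Suc n)) * p1 - a * r * p0)
        + (real (Suc (Suc n)) - U (Suc (Suc n))) * (y - V (Suc (Suc n))) * p1"
      using e1 unfolding e2[symmetric] e3[symmetric] by (simp add: algebra_simps)
    then show ?thesis
      unfolding p_defs[symmetric] r_def \<kappa>_def V_def y_def of_nat_Suc by algebra
  qed
  show "?F = 0"
    using P_independent(1)[of "Suc n" ?F "r * ?G"] * by simp
  show "?G = 0"
    using P_independent(2)[of "Suc n" ?F "r * ?G"] * r by simp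
qed

text \<open>The left-hand side is \<open>a\<close> times the determinant of the matrix that takes
  \<open>(P\<^sub>n\<^sub>+\<^sub>1, P\<^sub>n)\<close> at \<open>x\<close> to \<open>y (P\<^sub>n\<^sub>+\<^sub>1, P\<^sub>n)\<close> at \<open>x + 1\<close>.\<close>

lemma determinant:
  "(y + U (Suc n)) * (a * (y + U n) + (y - V n) * (y - (B n + \<gamma>)))
     + (real (Suc n) - U (Suc n)) * (y - V (Suc n)) * (y - V n)
   = y * (y - \<gamma> + 1) * (y + \<beta> - \<gamma>)"
proof (induction n)
  case 0
  have "[:0, 1:] = P 1 + [:B 0:]"
    using P_recurrence[of 0] by (simp add: P_0 one_pCons)
  then have "P 1 = [:0, 1:] - [:B 0:]"
    by (metis add_diff_cancel_right')
  then have P1: "P 1 = [:- B 0, 1:]"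
    by simp
  have "U 1 * (B 0 + \<gamma>) + (1 - U 1) * V 1 = 0"
    using structure_relation[of 0 1] by (simp add: P1[unfolded One_nat_def] P_0 algebra_simps)
  moreover have "a * U 1 = a - ((a + 1 - \<beta>) * B 0 + a * \<gamma> - (B 0)\<^sup>2)"
    using A_1_sq A_sq[of 1] by (simp add: algebra_simps)
  moreover have "V 0 = \<gamma> - \<beta> + a - B 0"
    by (simp add: V_def)
  ultimately have "(y + U 1) * (a * y + (y - V 0) * (y - (B 0 + \<gamma>)))
     + (1 - U 1) * (y - V 1) * (y - V 0) = y * (y - \<gamma> + 1) * (y + \<beta> - \<gamma>)"
    by algebra
  then show ?case
    by simp
next
  case (Suc n)
  have "(y + U (Suc (Suc n))) * (a * (y + U (Suc n)) + (y - V (Suc n)) * (y - (B (Suc n) + \<gamma>)))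
     + (real (Suc (Suc n)) - U (Suc (Suc n))) * (y - V (Suc (Suc n))) * (y - V (Suc n))
     = (y + U (Suc n)) * (a * (y + U n) + (y - V n) * (y - (B n + \<gamma>)))
     + (real (Suc n) - U (Suc n)) * (y - V (Suc n)) * (y - V n)"
    using compatibility[of n] unfolding B_eq of_nat_Suc by algebra
  with Suc.IH show ?case
    by simp
qed

lemma U_V_equation:
  "a * (V n + U (Suc n)) * (V n + U n) = V n * (V n - \<gamma> + 1) * (V n + \<beta> - \<gamma>)"
  using determinant[of "V n" n] by (simp add: algebra_simps)

lemma V_U_equation:
  "(real (Suc n) - U (Suc n)) * (U (Suc n) + V (Suc n)) * (U (Suc n) + V n)
   = - U (Suc n) * (U (Suc n) + \<gamma> - 1) * (U (Suc n) + \<gamma> - \<beta>)"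
  using determinant[of "- U (Suc n)" n] by (simp add: algebra_simps)

end

theorem theorem3p1:
  fixes \<gamma> \<beta> a :: real and p :: "nat \<Rightarrow> real poly"
  assumes "\<gamma> > 0" and "\<beta> > 0" and "a > 0" and "\<gamma> \<noteq> 1"
    and "orthonormal_polys (gen_meixner_weight \<gamma> \<beta> a) p"
  shows "\<exists>A b u v :: nat \<Rightarrow> real.
    three_term_recurrence p A b \<and>
    A 0 = 0 \<and>
    b 0 = \<gamma> * a / \<beta> * (kummer_M (\<gamma> + 1) (\<beta> + 1) a / kummer_M \<gamma> \<beta> a) \<and>
    (\<forall>n. (A n)\<^sup>2 = real n * a - (\<gamma> - 1) * u n) \<and>
    (\<forall>n. b n = real n + \<gamma> - \<beta> + a - (\<gamma> - 1) * v n / a) \<and>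
    (\<forall>n. (u n + v n) * (u (n + 1) + v n) =
       (\<gamma> - 1) / a\<^sup>2 * v n * (v n - a) * (v n - a * ((\<gamma> - \<beta>) / (\<gamma> - 1)))) \<and>
    (\<forall>n\<ge>1. (u n + v n) * (u n + v (n - 1)) =
       u n / (u n - a * real n / (\<gamma> - 1)) * (u n + a) *
       (u n + a * ((\<gamma> - \<beta>) / (\<gamma> - 1))))"
proof -
  interpret gen_meixner_polys \<gamma> \<beta> a p
    using assms by unfold_locales
  define s where "s = a / (\<gamma> - 1)"
  have s: "s * (\<gamma> - 1) = a" "(\<gamma> - 1) / a\<^sup>2 * s = 1 / a" "s \<noteq> 0"
    using assms by (simp_all add: s_def power2_eq_square)
  have eq1: "(s * U n + s * V n) * (s * U (n + 1) + s * V n) =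
      (\<gamma> - 1) / a\<^sup>2 * (s * V n) * (s * V n - a) * (s * V n - a * ((\<gamma> - \<beta>) / (\<gamma> - 1)))" for n
  proof -
    have "(s * U n + s * V n) * (s * U (n + 1) + s * V n)
        = s\<^sup>2 / a * (a * (V n + U (Suc n)) * (V n + U n))"
      using pos(3) by (simp add: power2_eq_square algebra_simps)
    also have "\<dots> = s\<^sup>2 / a * (V n * (V n - \<gamma> + 1) * (V n + \<beta> - \<gamma>))"
      unfolding U_V_equation ..
    also have "\<dots> = (1 / a) * V n * (s * V n - s * (\<gamma> - 1)) * (s * V n - s * (\<gamma> - \<beta>))"
      by (simp add: power2_eq_square add_divide_distrib diff_divide_distrib algebra_simps)
    also have "\<dots> = (\<gamma> - 1) / a\<^sup>2 * (s * V n) * (s * V n - a) * (s * V n - a * ((\<gamma> - \<beta>) / (\<gamma> - 1)))"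
      unfolding s(1) s(2)[symmetric] by (simp add: s_def)
    finally show ?thesis .
  qed
  have eq2: "(s * U n + s * V n) * (s * U n + s * V (n - 1)) =
      s * U n / (s * U n - a * real n / (\<gamma> - 1)) * (s * U n + a) *
      (s * U n + a * ((\<gamma> - \<beta>) / (\<gamma> - 1)))" if "n \<ge> 1" for n
  proof -
    obtain m where m: "n = Suc m"
      using \<open>n \<ge> 1\<close> by (cases n) auto
    define r where "r = real n - U n"
    have "(A n)\<^sup>2 > 0"
      using A_pos[of n] \<open>n \<ge> 1\<close> by simp
    then have r: "r \<noteq> 0"
      unfolding A_sq r_def[symmetric] by auto
    have "(s * U n + s * V n) * (s * U n + s * V (n - 1))
        = s\<^sup>2 / r * (r * (U n + V n) * (U n + V m))"
      using r by (simp add: m power2_eq_square algebra_simps)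
    also have "\<dots> = s\<^sup>2 / r * (- U n * (U n + \<gamma> - 1) * (U n + \<gamma> - \<beta>))"
      using V_U_equation[of m] by (simp only: m r_def)
    also have "\<dots> = (s * U n / (s * (- r))) * (s * U n + s * (\<gamma> - 1)) * (s * U n + s * (\<gamma> - \<beta>))"
      using s(3) by (simp add: power2_eq_square add_divide_distrib diff_divide_distrib algebra_simps)
    also have "s * (- r) = s * U n - a * real n / (\<gamma> - 1)"
      by (simp add: r_def s_def algebra_simps)
    finally show ?thesis
      unfolding s(1) by (simp add: s_def)
  qed
  have "(A n)\<^sup>2 = real n * a - (\<gamma> - 1) * (s * U n)" for n
    using s(1) A_sq[of n] by (simp add: algebra_simps flip: mult.assoc)
  moreover have "B n = real n + \<gamma> - \<beta> + a - (\<gamma> - 1) * (s * V n) / a" for n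
    using assms B_eq[of n] by (simp add: s_def)
  ultimately show ?thesis
    using three_term B_0_kummer A_0 eq1 eq2
    by (intro exI[of _ A] exI[of _ B] exI[of _ "\<lambda>n. s * U n"] exI[of _ "\<lambda>n. s * V n"]) blast
qed

end
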